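(* Let $\mathcal A$ denote the two-spin algebra $\mathrm{Mat}(2,\mathbb C)\otimes\mathrm{Mat}(2,\mathbb C)\cong\mathrm{Mat}(4,\mathbb C)$, or its real image $\Phi(\mathrm{Mat}(4,\mathbb C))\subset\mathrm{Mat}(8,\mathbb R)$. There exists no injective algebra homomorphism $\varphi$ from $\mathcal A$ into any commutative Kolmogorov algebra $\mathcal C(\Lambda)$ that preserves the CHSH element (equivalently, its spectrum or operator norm).
   Context: $\Phi$ is the realification map: for $U=A+iB$ with $A,B\in\mathrm{Mat}(4,\mathbb R)$, $\Phi(U):=A\otimes I+B\otimes W\in\mathrm{Mat}(8,\mathbb R)$, where $I$ is the $2\times2$ identity and $W=\begin{pmatrix}0&-1\\1&0\end{pmatrix}$. A commutative Kolmogorov algebra is $\mathcal C(\Lambda)\cong L^\infty(\Lambda)$ for a probability space $\Lambda$ (or $\mathbb R^N$ when $\Lambda$ is finite with $N$ points), with pointwise operations. The CHSH element is $S=A_0B_0+A_0B_1+A_1B_0-A_1B_1\in\mathcal A$, where $A_0,A_1\in\mathrm{Mat}(2,\mathbb C)\otimes I$ and $B_0,B_1\in I\otimes\mathrm{Mat}(2,\mathbb C)$ are $\pm1$ observables (Hermitian with square equal to the identity), so $[A_x,B_y]=0$, chosen so that $\operatorname{spec}(S)=\{2\sqrt2,-2\sqrt2,0,0\}$ and $\|S\|=2\sqrt2$ (or the image of this element under $\Phi$). That $\varphi$ preserves the CHSH element means that $\varphi(S)=\varphi(A_0)\varphi(B_0)+\varphi(A_0)\varphi(B_1)+\varphi(A_1)\varphi(B_0)-\varphi(A_1)\varphi(B_1)$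 has the same spectrum (equivalently, the same norm) as $S$. *)

theory Defs
  imports
    "HOL-Algebra.Module"
    "HOL-Analysis.Analysis"
    "HOL-Probability.Probability_Measure"
    "HOL-Probability.Essential_Supremum"
    "HOL-Computational_Algebra.Polynomial"
begin

section \<open>Algebras over a field\<close>

text \<open>
  An algebra over the field given by the type \<open>'k\<close> is a record of type
  \<open>('k, 'b) module\<close>; scalars range over the whole type.
\<close>

text \<open>Homomorphisms are linear and multiplicative; they need not preserve the unit.\<close>

definition alg_hom :: "('k, 'a, 'm) module_scheme \<Rightarrow> ('k, 'b, 'n) module_scheme \<Rightarrow> ('a \<Rightarrow> 'b) set" where
  "alg_hom A B = {\<phi>. \<phi> \<in> hom A B \<and> \<phi> \<in> hom (add_monoid A) (add_monoid B) \<and>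
     (\<forall>c. \<forall>x \<in> carrier A. \<phi> (c \<odot>\<^bsub>A\<^esub> x) = c \<odot>\<^bsub>B\<^esub> \<phi> x)}"

definition spectrum :: "('k, 'a, 'm) module_scheme \<Rightarrow> 'a \<Rightarrow> 'k set" where
  "spectrum A a = {c. c \<odot>\<^bsub>A\<^esub> \<one>\<^bsub>A\<^esub> \<ominus>\<^bsub>A\<^esub> a \<notin> Units A}"

definition restrict_real :: "('k::real_algebra_1, 'a) module \<Rightarrow> (real, 'a) module" where
  "restrict_real A =
     \<lparr>carrier = carrier A, monoid.mult = monoid.mult A, one = \<one>\<^bsub>A\<^esub>, zero = \<zero>\<^bsub>A\<^esub>, add = add A,
      module.smult = (\<lambda>r x. of_real r \<odot>\<^bsub>A\<^esub> x)\<rparr>"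


section \<open>Matrices\<close>

text \<open>
  The index type of a tensor product of matrix algebras is the product of the index types, so
  \<open>Mat(2,\<complex>) \<otimes> Mat(2,\<complex>)\<close> is the type \<open>complex^(2 \<times> 2)^(2 \<times> 2)\<close>, and the real \<open>8 \<times> 8\<close>
  matrices are indexed by \<open>(2 \<times> 2) \<times> 2\<close>.
\<close>

definition mat_algebra :: "('k::field, 'k^'n^'n) module" where
  "mat_algebra =
     \<lparr>carrier = UNIV, monoid.mult = (**), one = mat 1, zero = 0, add = (+),
      module.smult = (\<lambda>c. map_matrix ((*) c))\<rparr>"

definition kron :: "'a::semiring_1^'m^'m \<Rightarrow> 'a^'n^'n \<Rightarrow> 'a^('m::finite \<times> 'n::finite)^('m \<times> 'n)" where
  "kron A B = (\<chi> p q. A $ fst p $ fst q * B $ snd p $ snd q)"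

definition W :: "real^2^2" where
  "W = vector [vector [0, -1], vector [1, 0]]"

definition Phi :: "complex^'n^'n \<Rightarrow> real^('n::finite \<times> 2)^('n \<times> 2)" where
  "Phi U = kron (map_matrix Re U) (mat 1) + kron (map_matrix Im U) W"

definition real_image_algebra :: "(real, real^('n::finite \<times> 2)^('n \<times> 2)) module" where
  "real_image_algebra = mat_algebra\<lparr>carrier := range (Phi :: complex^'n^'n \<Rightarrow> _)\<rparr>"

definition observable :: "complex^'n^'n \<Rightarrow> bool" where
  "observable A \<longleftrightarrow> transpose (map_matrix cnj A) = A \<and> A ** A = mat 1"

definition charpoly :: "'k::field^'n^'n \<Rightarrow> 'k poly" where
  "charpoly A = det (mat [:0, 1:] - map_matrix (\<lambda>c. [:c:]) A)"

text \<open>The eigenvalues, repeated according to algebraic multiplicity.\<close>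

definition spec_mset :: "complex^'n^'n \<Rightarrow> complex multiset" where
  "spec_mset A = proots (charpoly A)"


section \<open>The algebra of essentially bounded functions\<close>

definition Linf_fun :: "'a measure \<Rightarrow> ('a \<Rightarrow> 'k::{real_normed_field, second_countable_topology}) set" where
  "Linf_fun M = {f \<in> borel_measurable M. \<exists>C. AE x in M. norm (f x) \<le> C}"

definition Linf_class ::
  "'a measure \<Rightarrow> ('a \<Rightarrow> 'k::{real_normed_field, second_countable_topology}) \<Rightarrow> ('a \<Rightarrow> 'k) set" where
  "Linf_class M f = {g \<in> Linf_fun M. AE x in M. g x = f x}"

definition Linf ::
  "'a measure \<Rightarrow> ('k::{real_normed_field, second_countable_topology}, ('a \<Rightarrow> 'k) set) module" where
  "Linf M =
     \<lparr>carrier = Linf_class M ` Linf_fun M,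
      monoid.mult = (\<lambda>X Y. \<Union>f\<in>X. \<Union>g\<in>Y. Linf_class M (\<lambda>x. f x * g x)),
      one = Linf_class M (\<lambda>_. 1),
      zero = Linf_class M (\<lambda>_. 0),
      add = (\<lambda>X Y. \<Union>f\<in>X. \<Union>g\<in>Y. Linf_class M (\<lambda>x. f x + g x)),
      module.smult = (\<lambda>c X. \<Union>f\<in>X. Linf_class M (\<lambda>x. c * f x))\<rparr>"

definition Linf_norm ::
  "'a measure \<Rightarrow> ('a \<Rightarrow> 'k::{real_normed_field, second_countable_topology}) set \<Rightarrow> real" where
  "Linf_norm M X = the_elem ((\<lambda>f. real_of_ereal (esssup M (\<lambda>x. ereal (norm (f x))))) ` X)"

lemma Linf_class_self: "f \<in> Linf_fun M \<Longrightarrow> f \<in> Linf_class M f"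
  by (simp add: Linf_class_def)

lemma Linf_class_cong:
  assumes "AE x in M. f x = g x"
  shows "Linf_class M f = Linf_class M g"
proof -
  have "(AE x in M. h x = f x) \<longleftrightarrow> (AE x in M. h x = g x)" for h
  proof
    assume "AE x in M. h x = f x"
    with assms show "AE x in M. h x = g x" by eventually_elim simp
  next
    assume "AE x in M. h x = g x"
    with assms show "AE x in M. h x = f x" by eventually_elim simp
  qed
  then show ?thesis by (simp add: Linf_class_def)
qed

lemma Linf_fun_const: "(\<lambda>_. c) \<in> Linf_fun M"
  unfolding Linf_fun_def by (auto intro!: exI[of _ "norm c"])

lemma Linf_fun_mult:
  assumes "f \<in> Linf_fun M" "g \<in> Linf_fun M"
  shows "(\<lambda>x. f x * g x) \<in> Linf_fun M"
proof -
  obtain C D where C: "AE x in M. norm (f x) \<le> C" and D: "AE x in M. norm (g x) \<le> D"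
    using assms by (auto simp: Linf_fun_def)
  from C D have "AE x in M. norm (f x * g x) \<le> C * D"
  proof eventually_elim
    case (elim x)
    then have "norm (f x) * norm (g x) \<le> C * D"
      by (intro mult_mono) (auto intro: order_trans[OF norm_ge_zero])
    then show ?case by (simp add: norm_mult)
  qed
  then show ?thesis using assms by (auto simp: Linf_fun_def)
qed

lemma Linf_fun_add:
  assumes "f \<in> Linf_fun M" "g \<in> Linf_fun M"
  shows "(\<lambda>x. f x + g x) \<in> Linf_fun M"
proof -
  obtain C D where C: "AE x in M. norm (f x) \<le> C" and D: "AE x in M. norm (g x) \<le> D"
    using assms by (auto simp: Linf_fun_def)
  from C D have "AE x in M. norm (f x + g x) \<le> C + D"
    by eventually_elim (rule norm_triangle_mono)
  then show ?thesis using assms by (auto simp: Linf_fun_def)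
qed

lemma Linf_mult_class:
  assumes "f \<in> Linf_fun M" "g \<in> Linf_fun M"
  shows "Linf_class M f \<otimes>\<^bsub>Linf M\<^esub> Linf_class M g = Linf_class M (\<lambda>x. f x * g x)"
proof -
  have *: "Linf_class M (\<lambda>x. f' x * g' x) = Linf_class M (\<lambda>x. f x * g x)"
    if "f' \<in> Linf_class M f" "g' \<in> Linf_class M g" for f' g'
  proof (rule Linf_class_cong)
    have "AE x in M. f' x = f x" "AE x in M. g' x = g x"
      using that by (auto simp: Linf_class_def)
    then show "AE x in M. f' x * g' x = f x * g x" by eventually_elim simp
  qed
  have "(\<Union>f'\<in>Linf_class M f. \<Union>g'\<in>Linf_class M g. Linf_class M (\<lambda>x. f' x * g' x))
      = (\<Union>f'\<in>Linf_class M f. \<Union>g'\<in>Linf_class M g. Linf_class M (\<lambda>x. f x * g x))"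
    by (intro SUP_cong refl *)
  also have "\<dots> = Linf_class M (\<lambda>x. f x * g x)"
    using Linf_class_self[OF assms(1)] Linf_class_self[OF assms(2)] by blast
  finally show ?thesis by (simp add: Linf_def)
qed

lemma Linf_add_class:
  assumes "f \<in> Linf_fun M" "g \<in> Linf_fun M"
  shows "Linf_class M f \<oplus>\<^bsub>Linf M\<^esub> Linf_class M g = Linf_class M (\<lambda>x. f x + g x)"
proof -
  have *: "Linf_class M (\<lambda>x. f' x + g' x) = Linf_class M (\<lambda>x. f x + g x)"
    if "f' \<in> Linf_class M f" "g' \<in> Linf_class M g" for f' g'
  proof (rule Linf_class_cong)
    have "AE x in M. f' x = f x" "AE x in M. g' x = g x"
      using that by (auto simp: Linf_class_def)
    then show "AE x in M. f' x + g' x = f x + g x" by eventually_elim simp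
  qed
  have "(\<Union>f'\<in>Linf_class M f. \<Union>g'\<in>Linf_class M g. Linf_class M (\<lambda>x. f' x + g' x))
      = (\<Union>f'\<in>Linf_class M f. \<Union>g'\<in>Linf_class M g. Linf_class M (\<lambda>x. f x + g x))"
    by (intro SUP_cong refl *)
  also have "\<dots> = Linf_class M (\<lambda>x. f x + g x)"
    using Linf_class_self[OF assms(1)] Linf_class_self[OF assms(2)] by blast
  finally show ?thesis by (simp add: Linf_def)
qed

lemma Linf_smult_class:
  assumes "f \<in> Linf_fun M"
  shows "c \<odot>\<^bsub>Linf M\<^esub> Linf_class M f = Linf_class M (\<lambda>x. c * f x)"
proof -
  have *: "Linf_class M (\<lambda>x. c * f' x) = Linf_class M (\<lambda>x. c * f x)"
    if "f' \<in> Linf_class M f" for f'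
  proof (rule Linf_class_cong)
    have "AE x in M. f' x = f x"
      using that by (auto simp: Linf_class_def)
    then show "AE x in M. c * f' x = c * f x" by eventually_elim simp
  qed
  have "(\<Union>f'\<in>Linf_class M f. Linf_class M (\<lambda>x. c * f' x))
      = (\<Union>f'\<in>Linf_class M f. Linf_class M (\<lambda>x. c * f x))"
    by (intro SUP_cong refl *)
  also have "\<dots> = Linf_class M (\<lambda>x. c * f x)"
    using Linf_class_self[OF assms] by blast
  finally show ?thesis by (simp add: Linf_def)
qed

lemma Linf_norm_class:
  assumes "f \<in> Linf_fun M"
  shows "Linf_norm M (Linf_class M f) = real_of_ereal (esssup M (\<lambda>x. ereal (norm (f x))))"
proof -
  have *: "esssup M (\<lambda>x. ereal (norm (g x))) = esssup M (\<lambda>x. ereal (norm (f x)))"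
    if "g \<in> Linf_class M f" for g
  proof (rule esssup_AE_cong)
    have "g \<in> borel_measurable M" "f \<in> borel_measurable M"
      using that assms by (auto simp: Linf_class_def Linf_fun_def)
    then show "(\<lambda>x. ereal (norm (g x))) \<in> borel_measurable M"
      and "(\<lambda>x. ereal (norm (f x))) \<in> borel_measurable M" by measurable
    have "AE x in M. g x = f x" using that by (auto simp: Linf_class_def)
    then show "AE x in M. ereal (norm (g x)) = ereal (norm (f x))" by eventually_elim simp
  qed
  have "(\<lambda>g. real_of_ereal (esssup M (\<lambda>x. ereal (norm (g x))))) ` Linf_class M f
      = (\<lambda>_. real_of_ereal (esssup M (\<lambda>x. ereal (norm (f x))))) ` Linf_class M f"
    by (intro image_cong refl arg_cong[where f = real_of_ereal] *)
  also have "\<dots> = {real_of_ereal (esssup M (\<lambda>x. ereal (norm (f x))))}"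
    by (rule image_constant[OF Linf_class_self[OF assms]])
  finally have "(\<lambda>g. real_of_ereal (esssup M (\<lambda>x. ereal (norm (g x))))) ` Linf_class M f
      = {real_of_ereal (esssup M (\<lambda>x. ereal (norm (f x))))}" .
  then show ?thesis by (simp add: Linf_norm_def)
qed

lemma Linf_cring:
  fixes M :: "'a measure"
  shows "cring (Linf M :: ('k::{real_normed_field, second_countable_topology}, ('a \<Rightarrow> 'k) set) module)"
    (is "cring ?L")
proof -
  have carr: "carrier ?L = Linf_class M ` Linf_fun M"
    and one: "\<one>\<^bsub>?L\<^esub> = Linf_class M (\<lambda>_. 1)" and zero: "\<zero>\<^bsub>?L\<^esub> = Linf_class M (\<lambda>_. 0)"
    by (simp_all add: Linf_def)
  note simps = carr one zero Linf_mult_class Linf_add_class Linf_fun_mult Linf_fun_add Linf_fun_const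
  have neg: "\<exists>g\<in>Linf_fun M. Linf_class M (\<lambda>x. g x + f x) = Linf_class M (\<lambda>_. 0)"
    if "f \<in> Linf_fun M" for f :: "'a \<Rightarrow> 'k"
    using Linf_fun_mult[OF Linf_fun_const that, of "-1"]
    by (intro bexI[of _ "\<lambda>x. -1 * f x"]) auto
  have "abelian_group ?L"
  proof (rule abelian_groupI)
    show "\<exists>y\<in>carrier ?L. y \<oplus>\<^bsub>?L\<^esub> x = \<zero>\<^bsub>?L\<^esub>" if x: "x \<in> carrier ?L" for x
    proof -
      obtain f where f: "f \<in> Linf_fun M" "x = Linf_class M f" using x by (auto simp: carr)
      obtain g where g: "g \<in> Linf_fun M" "Linf_class M (\<lambda>x. g x + f x) = Linf_class M (\<lambda>_. 0)"
        using neg[OF f(1)] by blast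
      then show ?thesis using f by (intro bexI[of _ "Linf_class M g"]) (simp_all add: simps)
    qed
  qed (auto simp: simps add_ac)
  moreover have "comm_monoid ?L"
    by (rule comm_monoidI) (auto simp: simps mult_ac)
  ultimately show ?thesis
    by (rule cringI) (auto simp: simps distrib_right)
qed
end

theory Submission
  imports Defs
begin

text \<open>
  A homomorphism into a commutative algebra sends \<open>X Y\<close> and \<open>Y X\<close> to the same element, so an
  injective one forces its domain to be commutative. The matrix algebra and its real image are not,
  whatever \<open>\<phi>\<close> does to the CHSH element.
\<close>

lemma inj_hom_into_cring_commute:
  assumes "cring R" and hom: "\<phi> \<in> hom A R" and inj: "inj_on \<phi> (carrier A)"
    and xy: "x \<in> carrier A" "y \<in> carrier A"
    and closed: "x \<otimes>\<^bsub>A\<^esub> y \<in> carrier A" "y \<otimes>\<^bsub>A\<^esub> x \<in> carrier A"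
  shows "x \<otimes>\<^bsub>A\<^esub> y = y \<otimes>\<^bsub>A\<^esub> x"
proof -
  interpret R: cring R by fact
  have "\<phi> (x \<otimes>\<^bsub>A\<^esub> y) = \<phi> (y \<otimes>\<^bsub>A\<^esub> x)"
    using xy by (simp add: hom_mult[OF hom] R.m_comm hom_in_carrier[OF hom])
  \<comment> \<open>\<open>A\<close> is a bare record, so \<open>closed\<close> supplies the
    membership of both products that injectivity on the carrier requires.\<close>
  then show ?thesis using inj closed by (auto dest: inj_onD)
qed

text \<open>\<open>hom\<close> sees only carrier and product, and restriction of scalars changes
  neither, so real-linear and complex-linear maps can be treated alike.\<close>

lemma hom_restrict_real:
  "hom (restrict_real A) B = hom A B" "hom A (restrict_real B) = hom A B"
  by (simp_all add: hom_def restrict_real_def)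

lemma matrix_mult_not_commute:
  fixes p q :: "'n::finite"
  assumes "p \<noteq> q"
  shows "\<exists>X Y :: 'a::semiring_1^'n^'n. X ** Y \<noteq> Y ** X"
proof -
  \<comment> \<open>Matrix units: \<open>X\<close> is E_pq and \<open>Y\<close> is E_qq. Then E_pq
    E_qq = E_pq, while E_qq E_pq = 0 because p and q differ; the entry at (p, q) separates the
    products.\<close>
  define X :: "'a^'n^'n" where "X = (\<chi> i j. if i = p \<and> j = q then 1 else 0)"
  define Y :: "'a^'n^'n" where "Y = (\<chi> i j. if i = q \<and> j = q then 1 else 0)"
  have "(X ** Y) $ p $ q = (\<Sum>k\<in>UNIV. X $ p $ k * Y $ k $ q)"
    by (simp add: matrix_matrix_mult_def)
  also have "\<dots> = (\<Sum>k\<in>UNIV. if k = q then 1 else 0)"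
    by (intro sum.cong) (auto simp: X_def Y_def)
  finally have "(X ** Y) $ p $ q = 1" by simp
  moreover have "(Y ** X) $ p $ q = 0"
    using assms by (simp add: matrix_matrix_mult_def X_def Y_def)
  ultimately have "X ** Y \<noteq> Y ** X" by auto
  then show ?thesis by blast
qed

lemma Phi_nth:
  "Phi U $ (i, a) $ (j, b) = Re (U $ i $ j) * (if a = b then 1 else 0) + Im (U $ i $ j) * W $ a $ b"
  by (simp add: Phi_def kron_def map_matrix_def mat_def)

lemma W_nth: "W $ 1 $ 1 = 0" "W $ 1 $ 2 = -1" "W $ 2 $ 1 = 1" "W $ 2 $ 2 = 0"
  by (simp_all add: W_def)

text \<open>\<open>W\<close> squares to minus the identity, so it plays the role of the imaginary
  unit.\<close>

lemma Phi_mult: "Phi (U ** V) = Phi U ** Phi V"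
proof -
  have "Phi (U ** V) $ (i, a) $ (j, b) = (Phi U ** Phi V) $ (i, a) $ (j, b)" for i j a b
  proof -
    have "(Phi U ** Phi V) $ (i, a) $ (j, b)
        = (\<Sum>k\<in>UNIV. \<Sum>c\<in>UNIV. Phi U $ (i, a) $ (k, c) * Phi V $ (k, c) $ (j, b))"
      by (simp add: matrix_matrix_mult_def sum.cartesian_product flip: UNIV_Times_UNIV)
    \<comment> \<open>Within each 2 x 2 block the four positions give Re, -Im, Im, Re of the complex
      matrix product.\<close>
    moreover have "a = 1 \<or> a = 2" "b = 1 \<or> b = 2" by (fact exhaust_2)+
    ultimately show ?thesis
      by (auto simp: Phi_nth W_nth matrix_matrix_mult_def UNIV_2 sum_negf
          sum_subtractf sum.distrib algebra_simps)
  qed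
  then show ?thesis by (simp add: vec_eq_iff)
qed

lemma inj_Phi: "inj Phi"
proof (rule injI)
  fix U V :: "complex^'n^'n"
  assume eq: "Phi U = Phi V"
  have "U $ i $ j = V $ i $ j" for i j
    \<comment> \<open>The first column of each block holds the real part above the imaginary
      part.\<close>
    using arg_cong[OF eq, of "\<lambda>A. A $ (i, 1) $ (j, 1)"] arg_cong[OF eq, of "\<lambda>A. A $ (i, 2) $ (j, 1)"]
    by (simp add: Phi_nth W_nth complex_eq_iff)
  then show "U = V" by (simp add: vec_eq_iff)
qed

theorem corollary7p3:
  fixes M :: "'m measure"
    and A0 A1 B0 B1 S :: "complex^(2 \<times> 2)^(2 \<times> 2)"
  assumes "prob_space M"
    and "A0 \<in> range (\<lambda>a. kron a (mat 1))" "A1 \<in> range (\<lambda>a. kron a (mat 1))"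
    and "B0 \<in> range (\<lambda>b. kron (mat 1) b)" "B1 \<in> range (\<lambda>b. kron (mat 1) b)"
    and "observable A0" "observable A1" "observable B0" "observable B1"
    and "S = A0 ** B0 + A0 ** B1 + A1 ** B0 - A1 ** B1"
    and "spec_mset S = {# complex_of_real (2 * sqrt 2), - complex_of_real (2 * sqrt 2), 0, 0 #}"
    and "onorm ((*v) S) = 2 * sqrt 2"
  shows
    "(\<nexists>\<phi>. \<phi> \<in> alg_hom (restrict_real mat_algebra) (Linf M :: (real, ('m \<Rightarrow> real) set) module) \<and>
        inj_on \<phi> (carrier (mat_algebra :: (complex, complex^(2 \<times> 2)^(2 \<times> 2)) module)) \<and>
        (complex_of_real ` spectrum (Linf M) (\<phi> S) = spectrum mat_algebra S \<or>
         Linf_norm M (\<phi> S) = onorm ((*v) S))) \<and>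
     (\<nexists>\<phi>. \<phi> \<in> alg_hom mat_algebra (Linf M :: (complex, ('m \<Rightarrow> complex) set) module) \<and>
        inj_on \<phi> (carrier (mat_algebra :: (complex, complex^(2 \<times> 2)^(2 \<times> 2)) module)) \<and>
        (spectrum (Linf M) (\<phi> S) = spectrum mat_algebra S \<or>
         Linf_norm M (\<phi> S) = onorm ((*v) S))) \<and>
     (\<nexists>\<phi>. \<phi> \<in> alg_hom real_image_algebra (Linf M :: (real, ('m \<Rightarrow> real) set) module) \<and>
        inj_on \<phi> (carrier (real_image_algebra :: (real, real^((2 \<times> 2) \<times> 2)^((2 \<times> 2) \<times> 2)) module)) \<and>
        (spectrum (Linf M) (\<phi> (Phi S)) = spectrum real_image_algebra (Phi S) \<or>
         Linf_norm M (\<phi> (Phi S)) = onorm ((*v) (Phi S)))) \<and>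
     (\<nexists>\<phi>. \<phi> \<in> alg_hom real_image_algebra
               (restrict_real (Linf M :: (complex, ('m \<Rightarrow> complex) set) module)) \<and>
        inj_on \<phi> (carrier (real_image_algebra :: (real, real^((2 \<times> 2) \<times> 2)^((2 \<times> 2) \<times> 2)) module)) \<and>
        (spectrum (Linf M) (\<phi> (Phi S)) = complex_of_real ` spectrum real_image_algebra (Phi S) \<or>
         Linf_norm M (\<phi> (Phi S)) = onorm ((*v) (Phi S))))"
proof -
  obtain X Y :: "complex^(2 \<times> 2)^(2 \<times> 2)" where XY: "X ** Y \<noteq> Y ** X"
    using matrix_mult_not_commute[of "(1, 1) :: 2 \<times> 2" "(1, 2)"] by auto
  then have PXY: "Phi X ** Phi Y \<noteq> Phi Y ** Phi X"
    by (simp add: inj_eq[OF inj_Phi] flip: Phi_mult)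
  \<comment> \<open>Stated for an arbitrary commutative ring \<open>R\<close>, so that it applies to
    \<open>Linf M\<close> over both the reals and the complex numbers.\<close>
  have mat: False
    if "cring R" "\<phi> \<in> hom mat_algebra R"
      "inj_on \<phi> (carrier (mat_algebra :: (complex, complex^(2 \<times> 2)^(2 \<times> 2)) module))"
    for R :: "('k, 'c) module" and \<phi>
    using inj_hom_into_cring_commute[OF that, of X Y] XY by (simp add: mat_algebra_def)
  have real_image: False
    if "cring R" "\<phi> \<in> hom real_image_algebra R"
      "inj_on \<phi> (carrier (real_image_algebra :: (real, real^((2 \<times> 2) \<times> 2)^((2 \<times> 2) \<times> 2)) module))"
    for R :: "('k, 'c) module" and \<phi>
    using inj_hom_into_cring_commute[OF that, of "Phi X" "Phi Y"] PXY
    \<comment> \<open>Read from right to left, \<open>Phi_mult\<close> also shows that both products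
      lie in the range of \<open>Phi\<close>.\<close>
    by (simp add: real_image_algebra_def mat_algebra_def flip: Phi_mult)
  show ?thesis
    \<comment> \<open>The first two conjuncts fall to \<open>mat\<close>, the last two to
      \<open>real_image\<close>; \<open>hom_restrict_real\<close> removes the scalar restriction in
      the first and the fourth.\<close>
    by (auto simp: alg_hom_def hom_restrict_real dest: mat[OF Linf_cring] real_image[OF Linf_cring])
qed

end
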